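(* For each integer $k \geq 1$, let $H_k$ be the graph obtained from $k$ pairwise disjoint $5$-cycles by choosing one vertex $x_i$ from the $i$-th cycle for each $i \in \{1,\dots,k\}$ and identifying $x_1,\dots,x_k$ into a single vertex. Then, for every $k \geq 1$, $\operatorname{mad}(H_k) = \frac{10k}{4k+1} < \frac{8}{3}$ and $H_k$ is not odd $4$-colorable. Consequently, the statement "if $G$ is a graph with $\operatorname{mad}(G) < \frac{4c}{c+2}$, then $\chi_o(G)\leq c$" is false for $c=4$, and there are infinitely many counterexamples.
   Context: All graphs are finite and simple (no loops, no parallel edges). The maximum average degree $\operatorname{mad}(G)$ of a graph $G$ is the maximum of $\frac{2|E(H)|}{|V(H)|}$ over all non-empty subgraphs $H$ of $G$. An odd $c$-coloring of a graph is a proper coloring of its vertices with (at most) $c$ colors such that, for each vertex $v$ of positive degree, some color appears an odd number of times on the neighborhood of $v$. A graph is odd $c$-colorable if it has an odd $c$-coloring. The odd chromatic number $\chi_o(G)$ is the minimum $c$ such that $G$ has an odd $c$-coloring. *)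

theory Defs
  imports Complex_Main
begin

datatype 'a graph = Graph (verts: "'a set") (edges: "'a set set")

definition simple_graph :: "'a graph \<Rightarrow> bool" where
  "simple_graph G \<longleftrightarrow> finite (verts G) \<and> (\<forall>e\<in>edges G. e \<subseteq> verts G \<and> card e = 2)"

definition subgraph :: "'a graph \<Rightarrow> 'a graph \<Rightarrow> bool" where
  "subgraph H G \<longleftrightarrow> simple_graph H \<and> verts H \<subseteq> verts G \<and> edges H \<subseteq> edges G"

definition neighborhood :: "'a graph \<Rightarrow> 'a \<Rightarrow> 'a set" where
  "neighborhood G v = {u. {u, v} \<in> edges G}"

definition graph_iso :: "'a graph \<Rightarrow> 'b graph \<Rightarrow> bool" where
  "graph_iso G H \<longleftrightarrow> (\<exists>f. bij_betw f (verts G) (verts H) \<and>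
     (\<forall>u\<in>verts G. \<forall>v\<in>verts G. {u, v} \<in> edges G \<longleftrightarrow> {f u, f v} \<in> edges H))"

text \<open>Unspecified (maximum of the empty set) for the graph without vertices.\<close>

definition mad :: "'a graph \<Rightarrow> real" where
  "mad G = Max {2 * real (card (edges H)) / real (card (verts H)) | H.
                  subgraph H G \<and> verts H \<noteq> {}}"

definition proper_coloring :: "'a graph \<Rightarrow> nat \<Rightarrow> ('a \<Rightarrow> nat) \<Rightarrow> bool" where
  "proper_coloring G c f \<longleftrightarrow> f ` verts G \<subseteq> {..<c} \<and>
     (\<forall>u\<in>verts G. \<forall>v\<in>verts G. {u, v} \<in> edges G \<longrightarrow> f u \<noteq> f v)"

definition odd_coloring :: "'a graph \<Rightarrow> nat \<Rightarrow> ('a \<Rightarrow> nat) \<Rightarrow> bool" where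
  "odd_coloring G c f \<longleftrightarrow> proper_coloring G c f \<and>
     (\<forall>v\<in>verts G. card (neighborhood G v) > 0 \<longrightarrow>
        (\<exists>a. odd (card {u \<in> neighborhood G v. f u = a})))"

definition odd_colorable :: "'a graph \<Rightarrow> nat \<Rightarrow> bool" where
  "odd_colorable G c \<longleftrightarrow> (\<exists>f. odd_coloring G c f)"

definition odd_chromatic_number :: "'a graph \<Rightarrow> nat" where
  "odd_chromatic_number G = (LEAST c. odd_colorable G c)"

text \<open>A cycle for \<open>n \<ge> 3\<close>.\<close>

definition cycle_graph :: "nat \<Rightarrow> nat graph" where
  "cycle_graph n = Graph {..<n} {{i, (i + 1) mod n} | i. i < n}"

definition disjoint_union :: "'i set \<Rightarrow> ('i \<Rightarrow> 'a graph) \<Rightarrow> ('i \<times> 'a) graph" where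
  "disjoint_union I G = Graph (Sigma I (\<lambda>i. verts (G i)))
     (\<Union>i\<in>I. (\<lambda>e. Pair i ` e) ` edges (G i))"

text \<open>
  Identifying all vertices of \<open>S\<close> into a single one: the vertices of the resulting graph are
  the classes of the partition whose only possibly nontrivial class is \<open>S\<close>. Using sets of edges
  merges parallel edges; the result has no loops if \<open>S\<close> is independent.
\<close>

definition identify :: "'a set \<Rightarrow> 'a graph \<Rightarrow> 'a set graph" where
  "identify S G = (let q = (\<lambda>v. if v \<in> S then S else {v})
     in Graph (q ` verts G) ((\<lambda>e. q ` e) ` edges G))"

definition H_graph :: "nat \<Rightarrow> (nat \<Rightarrow> nat) \<Rightarrow> (nat \<times> nat) set graph" where
  "H_graph k x = identify {(i, x i) | i. i \<in> {1..k}}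
                   (disjoint_union {1..k} (\<lambda>i. cycle_graph 5))"

text \<open>
  Every finite graph is isomorphic to one whose vertices are of any given infinite type, so
  fixing the vertex type to that of \<open>H_graph\<close> loses no finite graph.
\<close>

definition mad_bound_statement :: "nat \<Rightarrow> bool" where
  "mad_bound_statement c \<longleftrightarrow> (\<forall>G :: (nat \<times> nat) set graph.
     simple_graph G \<and> mad G < 4 * real c / (real c + 2) \<longrightarrow> odd_chromatic_number G \<le> c)"

definition mad_bound_counterexample :: "nat \<Rightarrow> 'a graph \<Rightarrow> bool" where
  "mad_bound_counterexample c G \<longleftrightarrow>
     simple_graph G \<and> mad G < 4 * real c / (real c + 2) \<and> \<not> odd_chromatic_number G \<le> c"

end

theory Submission
  imports Defs
begin

text \<open>
  A vertex of degree two is happy with an odd colouring only if its two neighbours have different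
  colours. On a \<open>5\<close>-cycle of \<open>H\<^sub>k\<close> with vertices \<open>v\<^sub>0, \<dots>, v\<^sub>4\<close>, where \<open>v\<^sub>0\<close> is the common
  vertex, this makes the colours of \<open>v\<^sub>0, v\<^sub>1, v\<^sub>2, v\<^sub>3\<close> and those of \<open>v\<^sub>0, v\<^sub>4, v\<^sub>3, v\<^sub>2\<close> pairwise
  distinct, so with four colours \<open>v\<^sub>1\<close> and \<open>v\<^sub>4\<close> agree and every colour appears an even number of
  times around \<open>v\<^sub>0\<close>.

  For the maximum average degree, let a subgraph have \<open>n\<^sub>i\<close> noncentral vertices and \<open>e\<^sub>i\<close> edges on
  the \<open>i\<close>-th cycle. Then \<open>4 e\<^sub>i \<le> 5 n\<^sub>i\<close>, and even \<open>e\<^sub>i \<le> n\<^sub>i\<close> if the subgraph misses the common vertex;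
  summing over \<open>i\<close> shows that the whole graph is the densest subgraph.
\<close>

section \<open>Odd colourings of arbitrary simple graphs\<close>

text \<open>If all vertices receive different colours, the colour of any neighbour appears exactly
  once. This guarantees that the minimum defining \<open>odd_chromatic_number\<close> is
  attained.\<close>

lemma ex_odd_coloring:
  assumes "simple_graph G"
  shows "odd_colorable G (card (verts G))"
proof -
  have fin: "finite (verts G)" and e: "\<And>e. e \<in> edges G \<Longrightarrow> e \<subseteq> verts G \<and> card e = 2"
    using assms by (auto simp: simple_graph_def)
  obtain f where "bij_betw f (verts G) {..<card (verts G)}"
    using ex_bij_betw_finite_nat[OF fin] by (auto simp: atLeast0LessThan)
  then have im: "f ` verts G = {..<card (verts G)}" and inj: "inj_on f (verts G)"
    by (auto simp: bij_betw_def)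
  have nb: "neighborhood G v \<subseteq> verts G" for v
    using e by (auto simp: neighborhood_def)
  have neq: "u \<noteq> v" if "{u, v} \<in> edges G" for u v
    using e[OF that] by auto
  have "\<exists>a. odd (card {u \<in> neighborhood G v. f u = a})" if "card (neighborhood G v) > 0" for v
  proof -
    have "neighborhood G v \<noteq> {}"
      using that by auto
    then obtain w where w: "w \<in> neighborhood G v"
      by blast
    then have "{u \<in> neighborhood G v. f u = f w} = {w}"
      using nb[of v] inj by (auto dest: inj_onD)
    then show ?thesis
      by (intro exI[of _ "f w"]) simp
  qed
  moreover have "proper_coloring G (card (verts G)) f"
    using im inj neq by (auto simp: proper_coloring_def dest: inj_onD)
  ultimately show ?thesis
    unfolding odd_colorable_def odd_coloring_def by blast
qed

lemma odd_colorable_mono: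
  assumes "odd_colorable G c" "c \<le> d"
  shows "odd_colorable G d"
proof -
  have "{..<c} \<subseteq> {..<d}"
    using assms(2) by simp
  then have "proper_coloring G d f" if "proper_coloring G c f" for f
    using that by (auto simp: proper_coloring_def)
  then show ?thesis
    using assms(1) unfolding odd_colorable_def odd_coloring_def by blast
qed

text \<open>Since some number of colours suffices, \<open>LEAST\<close> yields a genuine witness,
  and spare colours do no harm. Non-colourability thus becomes a lower bound on the odd chromatic
  number.\<close>

lemma odd_chromatic_number_le_iff:
  assumes "simple_graph G"
  shows "odd_chromatic_number G \<le> c \<longleftrightarrow> odd_colorable G c"
  unfolding odd_chromatic_number_def
proof
  assume "(LEAST c. odd_colorable G c) \<le> c"
  then show "odd_colorable G c"
    by (rule odd_colorable_mono[OF LeastI[of "odd_colorable G", OF ex_odd_coloring[OF assms]]])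
qed (rule Least_le)

text \<open>If the two neighbours shared a colour, every colour would appear zero or two times
  around \<open>v\<close>.\<close>

lemma odd_coloring_degree_2:
  assumes "odd_coloring G c f" "v \<in> verts G" "neighborhood G v = {u, w}" "u \<noteq> w"
  shows "f u \<noteq> f w"
proof
  assume "f u = f w"
  then have "{z \<in> {u, w}. f z = a} = (if a = f u then {u, w} else {})" for a
    by auto
  then have "even (card {z \<in> {u, w}. f z = a})" for a
    using assms(4) by simp
  then show False
    using assms by (auto simp: odd_coloring_def)
qed

section \<open>Isomorphism, subgraphs and maximum average degree\<close>

lemma graph_iso_card_verts: "graph_iso G H \<Longrightarrow> card (verts G) = card (verts H)"
  by (auto simp: graph_iso_def bij_betw_same_card)

text \<open>\<open>Max\<close> is only meaningful on a finite set, so \<open>mad\<close> needs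
  this.\<close>

lemma finite_subgraphs:
  assumes "simple_graph G"
  shows "finite {H. subgraph H G}"
proof (rule finite_subset)
  show "{H. subgraph H G} \<subseteq> (\<lambda>(V, E). Graph V E) ` (Pow (verts G) \<times> Pow (Pow (verts G)))"
  proof
    fix H assume "H \<in> {H. subgraph H G}"
    then show "H \<in> (\<lambda>(V, E). Graph V E) ` (Pow (verts G) \<times> Pow (Pow (verts G)))"
      by (cases H) (fastforce simp: subgraph_def simple_graph_def)
  qed
  show "finite ((\<lambda>(V, E). Graph V E) ` (Pow (verts G) \<times> Pow (Pow (verts G))))"
    using assms by (simp add: simple_graph_def)
qed

text \<open>The density comparison is cross-multiplied, which keeps it in the natural numbers and
  free of division by zero for the empty subgraph.\<close>

lemma mad_eqI:
  assumes "simple_graph G" "verts G \<noteq> {}"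
    and "\<And>H. subgraph H G \<Longrightarrow> card (edges H) * card (verts G) \<le> card (edges G) * card (verts H)"
  shows "mad G = 2 * real (card (edges G)) / real (card (verts G))"
  unfolding mad_def
proof (rule Max_eqI)
  show "finite {2 * real (card (edges H)) / real (card (verts H)) | H.
                  subgraph H G \<and> verts H \<noteq> {}}"
    using finite_subgraphs[OF assms(1)] by simp
  show "2 * real (card (edges G)) / real (card (verts G)) \<in>
    {2 * real (card (edges H)) / real (card (verts H)) | H. subgraph H G \<and> verts H \<noteq> {}}"
    using assms by (auto simp: subgraph_def)
next
  fix y
  assume "y \<in> {2 * real (card (edges H)) / real (card (verts H)) | H.
                  subgraph H G \<and> verts H \<noteq> {}}"
  then obtain H where y: "y = 2 * real (card (edges H)) / real (card (verts H))"
    and H: "subgraph H G" "verts H \<noteq> {}"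
    by auto
  have pos: "card (verts H) > 0" "card (verts G) > 0"
    using H assms(1,2) by (auto simp: subgraph_def simple_graph_def card_gt_0_iff)
  have "real (card (edges H)) * real (card (verts G)) \<le> real (card (edges G)) * real (card (verts H))"
    using assms(3)[OF H(1)] by (metis of_nat_le_iff of_nat_mult)
  then show "y \<le> 2 * real (card (edges G)) / real (card (verts G))"
    using pos by (simp add: y field_simps)
qed

section \<open>Bouquets of pentagons\<close>

text \<open>\<open>p i 0, \<dots>, p i 4\<close> are the vertices of the \<open>i\<close>-th cycle in order, \<open>p i 0\<close> being the common one.\<close>

locale pentagon_bouquet =
  fixes k :: nat and p :: "nat \<Rightarrow> nat \<Rightarrow> 'a" and G :: "'a graph"
  assumes k_pos: "k \<ge> 1"
    and p_eq_iff: "\<lbrakk>i \<in> {1..k}; i' \<in> {1..k}; a < 5; b < 5\<rbrakk> \<Longrightarrow>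
      p i a = p i' b \<longleftrightarrow> a = b \<and> (a = 0 \<or> i = i')"
    and verts_G: "verts G = (\<lambda>(i, j). p i j) ` ({1..k} \<times> {..<5})"
    and edges_G: "edges G = (\<lambda>(i, j). {p i j, p i (Suc j mod 5)}) ` ({1..k} \<times> {..<5})"
begin

lemma lessThan_5: "{..<5::nat} = {0, 1, 2, 3, 4}"
  by auto

lemma simple: "simple_graph G"
proof -
  have "p i j \<noteq> p i (Suc j mod 5)" if "i \<in> {1..k}" "j < 5" for i j
    using that by (simp add: p_eq_iff mod_Suc)
  then show ?thesis
    by (fastforce simp: simple_graph_def verts_G edges_G card_insert_if)
qed

lemma p_0: "i \<in> {1..k} \<Longrightarrow> p i 0 = p 1 0"
  using k_pos by (simp add: p_eq_iff)

lemma verts_eq: "verts G = insert (p 1 0) ((\<lambda>(i, j). p i j) ` ({1..k} \<times> {1..4}))"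
proof -
  have "{1..k} \<times> {..<5} = {1..k} \<times> {0} \<union> {1..k} \<times> {1..4::nat}"
    by auto
  moreover have "(\<lambda>(i, j). p i j) ` ({1..k} \<times> {0}) = (\<lambda>i. p i 0) ` {1..k}"
    by auto
  moreover have "(\<lambda>i. p i 0) ` {1..k} = (\<lambda>_. p 1 0) ` {1..k}"
    by (rule image_cong[OF refl p_0])
  moreover have "(\<lambda>_. p 1 0) ` {1..k} = {p 1 0}"
    using k_pos by (simp add: image_constant_conv)
  ultimately show ?thesis
    by (simp add: verts_G image_Un)
qed

lemma inj_noncentral: "inj_on (\<lambda>(i, j). p i j) ({1..k} \<times> {1..4})"
  by (auto simp: inj_on_def p_eq_iff)

lemma card_verts: "card (verts G) = 4 * k + 1"
proof -
  have "p 1 0 \<notin> (\<lambda>(i, j). p i j) ` ({1..k} \<times> {1..4})"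
    using k_pos by (auto simp: p_eq_iff)
  moreover have "card ((\<lambda>(i, j). p i j) ` ({1..k} \<times> {1..4})) = 4 * k"
    by (subst card_image[OF inj_noncentral]) simp
  ultimately show ?thesis
    by (simp add: verts_eq del: One_nat_def)
qed

lemma card_edges: "card (edges G) = 5 * k"
proof -
  have "inj_on (\<lambda>(i, j). {p i j, p i (Suc j mod 5)}) ({1..k} \<times> {..<5})"
  proof (rule inj_onI, clarsimp)
    fix i j i' j' :: nat
    assume "{p i j, p i (Suc j mod 5)} = {p i' j', p i' (Suc j' mod 5)}"
      and "Suc 0 \<le> i" "i \<le> k" "j < 5" "Suc 0 \<le> i'" "i' \<le> k" "j' < 5"
    \<comment> \<open>Every edge has a noncentral end, which determines the cycle; within a
      \<open>5\<close>-cycle distinct positions give distinct edges.\<close>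
    then show "i = i' \<and> j = j'"
      by (auto simp: doubleton_eq_iff p_eq_iff mod_Suc split: if_splits)
  qed
  then show ?thesis
    by (simp add: edges_G card_image)
qed

section \<open>Density of subgraphs of a bouquet\<close>

lemma subgraph_density:
  assumes "subgraph H G"
  shows "card (edges H) * card (verts G) \<le> card (edges G) * card (verts H)"
proof -
  define P where "P i j \<longleftrightarrow> p i j \<in> verts H" for i j
  \<comment> \<open>With \<open>0\<close>/\<open>1\<close> indicators, sums count vertices and
    products of consecutive indicators count the edges with both ends present.\<close>
  define b :: "nat \<Rightarrow> nat \<Rightarrow> nat" where "b i j = of_bool (P i j)" for i j
  have VH: "verts H \<subseteq> verts G" and EH: "edges H \<subseteq> edges G"
    and EV: "\<And>e. e \<in> edges H \<Longrightarrow> e \<subseteq> verts H"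
    using assms by (auto simp: subgraph_def simple_graph_def)
  have P0: "P i 0 \<longleftrightarrow> P 1 0" if "i \<in> {1..k}" for i
    using p_0[OF that] by (simp add: P_def)
  let ?N = "\<Sum>i\<in>{1..k}. b i 1 + b i 2 + b i 3 + b i 4"
  have card_V: "card (verts H) = b 1 0 + ?N"
  proof -
    define A where "A = {z \<in> {1..k} \<times> {1..4}. (\<lambda>(i, j). p i j) z \<in> verts H}"
    have "verts H = {v. v = p 1 0 \<and> P 1 0} \<union> (\<lambda>(i, j). p i j) ` A"
      using VH by (auto simp: verts_eq A_def P_def)
    also have "card \<dots> = card {v. v = p 1 0 \<and> P 1 0} + card ((\<lambda>(i, j). p i j) ` A)"
      using k_pos by (intro card_Un_disjoint) (auto simp: A_def p_eq_iff)
    also have "card {v. v = p 1 0 \<and> P 1 0} = b 1 0"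
      by (cases "P 1 0") (auto simp: b_def)
    also have "card ((\<lambda>(i, j). p i j) ` A) = card A"
      by (intro card_image inj_on_subset[OF inj_noncentral]) (auto simp: A_def)
    also have "\<dots> = (\<Sum>z\<in>{1..k} \<times> {1..4}. of_bool ((\<lambda>(i, j). p i j) z \<in> verts H))"
      by (simp add: A_def Int_def)
    also have "\<dots> = (\<Sum>i\<in>{1..k}. \<Sum>j\<in>{1..4}. b i j)"
      unfolding sum.cartesian_product by (rule sum.cong) (auto simp: b_def P_def)
    also have "\<dots> = ?N"
      by (simp add: numeral_eq_Suc add.assoc)
    finally show ?thesis .
  qed
  let ?e = "\<lambda>i. b i 0 * b i 1 + b i 1 * b i 2 + b i 2 * b i 3 + b i 3 * b i 4 + b i 4 * b i 0"
  \<comment> \<open>Only an inequality, as \<open>H\<close> need not be an induced subgraph.\<close>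
  have card_E: "card (edges H) \<le> (\<Sum>i\<in>{1..k}. ?e i)"
  proof -
    define A where "A = {(i, j) \<in> {1..k} \<times> {..<5}. P i j \<and> P i (Suc j mod 5)}"
    have "edges H \<subseteq> (\<lambda>(i, j). {p i j, p i (Suc j mod 5)}) ` A"
      using EH EV by (fastforce simp: edges_G A_def P_def)
    moreover have "finite A"
      by (rule finite_subset[of _ "{1..k} \<times> {..<5}"]) (auto simp: A_def)
    ultimately have "card (edges H) \<le> card A"
      by (meson card_image_le card_mono finite_imageI order_trans)
    also have "A = {z \<in> {1..k} \<times> {..<5}. (\<lambda>(i, j). P i j \<and> P i (Suc j mod 5)) z}"
      by (auto simp: A_def)
    also have "card \<dots> = (\<Sum>z\<in>{1..k} \<times> {..<5}. of_bool ((\<lambda>(i, j). P i j \<and> P i (Suc j mod 5)) z))"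
      by (simp add: Int_def)
    also have "\<dots> = (\<Sum>i\<in>{1..k}. \<Sum>j<5. b i j * b i (Suc j mod 5))"
      unfolding sum.cartesian_product by (rule sum.cong) (auto simp: b_def)
    also have "\<dots> = (\<Sum>i\<in>{1..k}. ?e i)"
      by (simp add: lessThan_5 add.assoc numeral_2_eq_2)
    finally show ?thesis .
  qed
  have "card (edges H) * (4 * k + 1) \<le> 5 * k * card (verts H)"
  proof (cases "P 1 0")
    case True
    \<comment> \<open>Equality occurs when all five vertices are present: five edges against four
      noncentral vertices. A proper part of the cycle is a forest, so with the centre present it has
      at most as many edges as noncentral vertices.\<close>
    have "4 * ?e i \<le> 5 * (b i 1 + b i 2 + b i 3 + b i 4)" for i
      by (simp add: b_def)
    then have "4 * (\<Sum>i\<in>{1..k}. ?e i) \<le> 5 * ?N"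
      unfolding sum_distrib_left by (rule sum_mono)
    then have "4 * card (edges H) \<le> 5 * ?N"
      using card_E by linarith
    moreover have V: "card (verts H) = 1 + ?N"
      using card_V True by (simp add: b_def)
    moreover have "card (verts H) \<le> 4 * k + 1"
      using VH simple card_mono[of "verts G" "verts H"] by (simp add: simple_graph_def card_verts)
    ultimately obtain n where n: "card (verts H) = 1 + n" "4 * card (edges H) \<le> 5 * n" "n \<le> 4 * k"
      by auto
    have "4 * card (edges H) * (4 * k + 1) \<le> 5 * n * (4 * k + 1)"
      using n(2) by (rule mult_right_mono) simp
    \<comment> \<open>After expanding and cancelling \<open>20 * k * n\<close>, this is
      \<open>5 * n \<le> 20 * k\<close>.\<close>
    also have "\<dots> \<le> 4 * (5 * k * (1 + n))"
      using n(3) by (simp add: algebra_simps)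
    finally show ?thesis
      by (simp add: n(1))
  next
    case False
    \<comment> \<open>Without the centre only a part of a path on four vertices remains.\<close>
    have "?e i \<le> b i 1 + b i 2 + b i 3 + b i 4" if "i \<in> {1..k}" for i
      using False P0[OF that] by (simp add: b_def)
    then have "(\<Sum>i\<in>{1..k}. ?e i) \<le> ?N"
      by (rule sum_mono)
    then have "card (edges H) \<le> card (verts H)"
      using card_E card_V by linarith
    \<comment> \<open>The second factors satisfy \<open>4 * k + 1 \<le> 5 * k\<close> because
      \<open>k \<ge> 1\<close>.\<close>
    then have "card (edges H) * (4 * k + 1) \<le> card (verts H) * (5 * k)"
      using k_pos by (intro mult_mono) auto
    then show ?thesis
      by (simp add: mult.commute)
  qed
  then show ?thesis
    by (simp add: card_verts card_edges)
qed

lemma mad: "mad G = 10 * real k / (4 * real k + 1)"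
proof -
  have "verts G \<noteq> {}"
    using card_verts by auto
  from mad_eqI[OF simple this subgraph_density] show ?thesis
    by (simp add: card_edges card_verts add.commute)
qed

section \<open>Neighbourhoods and the failure of odd \<open>4\<close>-colourability\<close>

lemma neighborhood_noncentral:
  assumes "i \<in> {1..k}" "a \<in> {1..4}"
  shows "neighborhood G (p i a) = {p i (a - 1), p i (Suc a mod 5)}"
proof -
  have "{u, p i a} \<in> edges G \<longleftrightarrow> u = p i (a - 1) \<or> u = p i (Suc a mod 5)" for u
  proof
    assume "{u, p i a} \<in> edges G"
    then obtain i' j where j: "i' \<in> {1..k}" "j < 5" "{u, p i a} = {p i' j, p i' (Suc j mod 5)}"
      by (auto simp: edges_G)
    then consider "p i a = p i' j" "u = p i' (Suc j mod 5)" | "p i a = p i' (Suc j mod 5)" "u = p i' j"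
      by (auto simp: doubleton_eq_iff)
    then show "u = p i (a - 1) \<or> u = p i (Suc a mod 5)"
      by cases (use assms j(1,2) in \<open>auto simp: p_eq_iff mod_Suc split: if_splits\<close>)
  next
    have "Suc (a - 1) mod 5 = a"
      using assms by auto
    moreover assume "u = p i (a - 1) \<or> u = p i (Suc a mod 5)"
    ultimately show "{u, p i a} \<in> edges G"
      using assms by (force simp: edges_G insert_commute)
  qed
  then show ?thesis
    by (auto simp: neighborhood_def)
qed

text \<open>Indexing by cycle and position exhibits the neighbours in pairs, one pair per cycle, as
  the parity argument needs.\<close>

lemma neighborhood_central:
  "neighborhood G (p 1 0) = (\<lambda>(i, j). p i j) ` ({1..k} \<times> {1, 4})"
proof -
  have "{u, p 1 0} \<in> edges G \<longleftrightarrow> (\<exists>i\<in>{1..k}. u = p i 1 \<or> u = p i 4)" for u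
  proof
    assume "{u, p 1 0} \<in> edges G"
    then obtain i j where j: "i \<in> {1..k}" "j < 5" "{u, p 1 0} = {p i j, p i (Suc j mod 5)}"
      by (auto simp: edges_G)
    then consider "p 1 0 = p i j" "u = p i (Suc j mod 5)" | "p 1 0 = p i (Suc j mod 5)" "u = p i j"
      by (auto simp: doubleton_eq_iff)
    then show "\<exists>i\<in>{1..k}. u = p i 1 \<or> u = p i 4"
    proof cases
      case 1
      then have "j = 0"
        using j k_pos by (simp add: p_eq_iff)
      then show ?thesis
        using 1 j by auto
    next
      case 2
      then have "Suc j mod 5 = 0"
        using j k_pos by (simp add: p_eq_iff)
      then have "j = 4"
        using j by (simp add: mod_Suc split: if_splits)
      then show ?thesis
        using 2 j by auto
    qed
  next
    assume "\<exists>i\<in>{1..k}. u = p i 1 \<or> u = p i 4"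
    then obtain i where i: "i \<in> {1..k}" "u = p i 1 \<or> u = p i 4"
      by blast
    have "{p i j, p i (Suc j mod 5)} \<in> edges G" if "j < 5" for j
      using i that by (auto simp: edges_G)
    from this[of 0] this[of 4] show "{u, p 1 0} \<in> edges G"
      using i p_0[OF i(1)] by (auto simp: insert_commute)
  qed
  then show ?thesis
    by (auto simp: neighborhood_def)
qed

lemma not_odd_4_colorable: "\<not> odd_colorable G 4"
proof
  assume "odd_colorable G 4"
  then obtain f where f: "odd_coloring G 4 f"
    by (auto simp: odd_colorable_def)
  have p_verts: "p i j \<in> verts G" if "i \<in> {1..k}" "j < 5" for i j
    using that by (auto simp: verts_G)
  have bound: "f (p i j) < 4" if "i \<in> {1..k}" "j < 5" for i j
    using f p_verts[OF that] by (auto simp: odd_coloring_def proper_coloring_def)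
  have dist1: "f (p i j) \<noteq> f (p i (Suc j mod 5))" if "i \<in> {1..k}" "j < 5" for i j
  proof -
    have "{p i j, p i (Suc j mod 5)} \<in> edges G"
      using that by (auto simp: edges_G)
    then show ?thesis
      using f p_verts that by (auto simp: odd_coloring_def proper_coloring_def)
  qed
  have dist2: "f (p i (a - 1)) \<noteq> f (p i (Suc a mod 5))" if "i \<in> {1..k}" "a \<in> {1..4}" for i a
  proof (rule odd_coloring_degree_2[OF f p_verts neighborhood_noncentral[OF that]])
    show "p i (a - 1) \<noteq> p i (Suc a mod 5)"
      using that by (auto simp: p_eq_iff mod_Suc)
  qed (use that in auto)
  have agree: "f (p i 1) = f (p i 4)" if i: "i \<in> {1..k}" for i
  proof -
    let ?c = "\<lambda>j. f (p i j)"
    have neq: "?c 0 \<noteq> ?c 1" "?c 1 \<noteq> ?c 2" "?c 2 \<noteq> ?c 3" "?c 3 \<noteq> ?c 4" "?c 4 \<noteq> ?c 0"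
      "?c 0 \<noteq> ?c 2" "?c 1 \<noteq> ?c 3" "?c 2 \<noteq> ?c 4" "?c 3 \<noteq> ?c 0"
      using dist1[OF i, of 0] dist1[OF i, of 1] dist1[OF i, of 2] dist1[OF i, of 3] dist1[OF i, of 4]
        dist2[OF i, of 1] dist2[OF i, of 2] dist2[OF i, of 3] dist2[OF i, of 4]
      by (simp_all add: numeral_2_eq_2)
    \<comment> \<open>Four distinct colours exhaust the palette, so \<open>?c 4\<close> is one of
      them; \<open>neq\<close> excludes all but \<open>?c 1\<close>.\<close>
    have "card {?c 0, ?c 1, ?c 2, ?c 3} = card {..<4::nat}"
      using neq by (simp add: card_insert_if)
    then have "{?c 0, ?c 1, ?c 2, ?c 3} = {..<4}"
      using bound[OF i] by (intro card_subset_eq) auto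
    then have "?c 4 \<in> {?c 0, ?c 1, ?c 2, ?c 3}"
      using bound[OF i] by simp
    then show ?thesis
      using neq by auto
  qed
  have "even (card {u \<in> neighborhood G (p 1 0). f u = a})" for a
  proof -
    \<comment> \<open>By \<open>agree\<close>, each cycle contributes both or neither of its two
      neighbours to a colour class, so the class has twice as many elements as there are
      contributing cycles.\<close>
    let ?A = "{i \<in> {1..k}. f (p i 1) = a} \<times> {1, 4::nat}"
    have "{u \<in> neighborhood G (p 1 0). f u = a} = (\<lambda>(i, j). p i j) ` ?A"
      using agree by (auto simp: neighborhood_central simp del: One_nat_def)
    moreover have "inj_on (\<lambda>(i, j). p i j) ?A"
      by (rule inj_on_subset[OF inj_noncentral]) auto
    ultimately show ?thesis
      by (simp add: card_image card_cartesian_product)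
  qed
  moreover have "card (neighborhood G (p 1 0)) > 0"
    using k_pos by (auto simp: neighborhood_central card_gt_0_iff simp del: One_nat_def)
  ultimately show False
    using f p_verts[of 1 0] k_pos by (auto simp: odd_coloring_def simp del: One_nat_def)
qed

end

section \<open>Identifying \<open>H_graph\<close> as a bouquet\<close>

lemma image_shift_mod:
  assumes "0 < (n::nat)"
  shows "(\<lambda>j. (x + j) mod n) ` {..<n} = {..<n}"
proof
  show "{..<n} \<subseteq> (\<lambda>j. (x + j) mod n) ` {..<n}"
  proof
    fix y assume "y \<in> {..<n}"
    \<comment> \<open>The preimage of \<open>y\<close> is \<open>y - x\<close> modulo
      \<open>n\<close>; adding \<open>n\<close> first avoids truncated subtraction.\<close>
    moreover have "x mod n + (y + (n - x mod n)) = y + n"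
      using assms mod_less_divisor[of n x] by linarith
    ultimately have "y = (x mod n + (y + (n - x mod n))) mod n"
      by simp
    then have "y = (x + (y + (n - x mod n)) mod n) mod n"
      by (simp add: mod_simps)
    then show "y \<in> (\<lambda>j. (x + j) mod n) ` {..<n}"
      using assms by (metis imageI lessThan_iff mod_less_divisor)
  qed
qed (use assms in auto)

text \<open>Rotating the \<open>i\<close>-th cycle by \<open>x i\<close> moves the chosen vertex to
  position \<open>0\<close>, so an arbitrary choice of \<open>x\<close> reduces to one
  labelling.\<close>

lemma pentagon_bouquet_H_graph:
  assumes k: "k \<ge> 1" and x: "\<forall>i\<in>{1..k}. x i < 5"
  defines "S \<equiv> {(i, x i) | i. i \<in> {1..k}}"
  shows "pentagon_bouquet k
    (\<lambda>i j. if (i, (x i + j) mod 5) \<in> S then S else {(i, (x i + j) mod 5)}) (H_graph k x)"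
proof -
  define q where "q v = (if v \<in> S then S else {v})" for v
  have "edges (cycle_graph 5) = (\<lambda>j. {j, Suc j mod 5}) ` {..<5}"
    by (auto simp: cycle_graph_def)
  moreover have "verts (cycle_graph 5) = {..<5}"
    by (simp add: cycle_graph_def)
  moreover have "q = (\<lambda>v. if v \<in> S then S else {v})"
    by (simp add: q_def fun_eq_iff)
  ultimately have H: "H_graph k x = Graph (q ` ({1..k} \<times> {..<5}))
      ((`) q ` (\<Union>i\<in>{1..k}. (`) (Pair i) ` (\<lambda>j. {j, Suc j mod 5}) ` {..<5}))"
    by (simp add: H_graph_def identify_def disjoint_union_def Let_def S_def)
  \<comment> \<open>A surjective self-map of a finite set is injective.\<close>
  have "inj_on (\<lambda>j. (x i + j) mod 5) {..<5}" for i
    by (rule finite_surj_inj) (simp_all add: image_shift_mod)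
  then have shift_inj: "(x i + a) mod 5 = (x i + b) mod 5 \<longleftrightarrow> a = b" if "a < 5" "b < 5" for i a b
    using that by (auto dest: inj_onD)
  have inS: "(i, (x i + a) mod 5) \<in> S \<longleftrightarrow> a = 0" if "i \<in> {1..k}" "a < 5" for i a
  proof -
    have "(x i + a) mod 5 = x i \<longleftrightarrow> a = 0"
      using shift_inj[of a 0 i] x that by simp
    then show ?thesis
      using that by (auto simp: S_def)
  qed
  have "pentagon_bouquet k (\<lambda>i j. q (i, (x i + j) mod 5)) (H_graph k x)"
  proof
    show "q (i, (x i + a) mod 5) = q (i', (x i' + b) mod 5) \<longleftrightarrow> a = b \<and> (a = 0 \<or> i = i')"
      if "i \<in> {1..k}" "i' \<in> {1..k}" "a < 5" "b < 5" for i i' a b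
      using that inS[of i a] inS[of i' b] shift_inj[of a b i] unfolding q_def
      by (auto split: if_splits)
    have "verts (H_graph k x) = (\<Union>i\<in>{1..k}. (\<lambda>j. q (i, j)) ` {..<5})"
      by (auto simp: H)
    also have "\<dots> = (\<Union>i\<in>{1..k}. (\<lambda>j. q (i, j)) ` (\<lambda>j. (x i + j) mod 5) ` {..<5})"
      by (simp add: image_shift_mod)
    also have "\<dots> = (\<lambda>(i, j). q (i, (x i + j) mod 5)) ` ({1..k} \<times> {..<5})"
      by (auto simp: image_iff)
    finally show "verts (H_graph k x) = (\<lambda>(i, j). q (i, (x i + j) mod 5)) ` ({1..k} \<times> {..<5})" .
    have "edges (H_graph k x) = (\<Union>i\<in>{1..k}. (\<lambda>j. {q (i, j), q (i, Suc j mod 5)}) ` {..<5})"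
      by (simp add: H image_UN image_image)
    also have "\<dots> = (\<Union>i\<in>{1..k}. (\<lambda>j. {q (i, j), q (i, Suc j mod 5)}) ` (\<lambda>j. (x i + j) mod 5) ` {..<5})"
      by (simp add: image_shift_mod)
    also have "\<dots> = (\<lambda>(i, j). {q (i, (x i + j) mod 5), q (i, (x i + Suc j mod 5) mod 5)}) ` ({1..k} \<times> {..<5})"
      by (fastforce simp: image_iff mod_simps)
    finally show "edges (H_graph k x) =
      (\<lambda>(i, j). {q (i, (x i + j) mod 5), q (i, (x i + Suc j mod 5) mod 5)}) ` ({1..k} \<times> {..<5})" .
  qed (fact k)
  then show ?thesis
    by (simp add: q_def)
qed

text \<open>The counterexamples are pairwise non-isomorphic because relabelling a single graph would
  already give an infinite set.\<close>

theorem mainTheorem4: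
  "(\<forall>k\<ge>1. \<forall>x. (\<forall>i\<in>{1..k}. x i \<in> verts (cycle_graph 5)) \<longrightarrow>
      simple_graph (H_graph k x) \<and>
      mad (H_graph k x) = 10 * real k / (4 * real k + 1) \<and>
      10 * real k / (4 * real k + 1) < 8 / 3 \<and>
      \<not> odd_colorable (H_graph k x) 4) \<and>
   \<not> mad_bound_statement 4 \<and>
   (\<exists>\<G> :: (nat \<times> nat) set graph set.
      infinite \<G> \<and>
      pairwise (\<lambda>G G'. \<not> graph_iso G G') \<G> \<and>
      (\<forall>G\<in>\<G>. mad_bound_counterexample 4 G))"
proof -
  have bouquet: "\<exists>p. pentagon_bouquet k p (H_graph k x)"
    if "k \<ge> 1" "\<forall>i\<in>{1..k}. x i \<in> verts (cycle_graph 5)" for k x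
    using pentagon_bouquet_H_graph[of k x] that by (auto simp: cycle_graph_def)
  \<comment> \<open>Clearing denominators gives \<open>30 * k < 32 * k + 8\<close>. The value
    \<open>8 / 3\<close> is \<open>4 * c / (c + 2)\<close> at \<open>c = 4\<close>.\<close>
  have bound: "10 * real k / (4 * real k + 1) < 8 / 3" for k
    by (simp add: field_simps)
  have main: "simple_graph (H_graph k x) \<and> mad (H_graph k x) = 10 * real k / (4 * real k + 1) \<and>
      10 * real k / (4 * real k + 1) < 8 / 3 \<and> \<not> odd_colorable (H_graph k x) 4"
    if "k \<ge> 1" "\<forall>i\<in>{1..k}. x i \<in> verts (cycle_graph 5)" for k x
  proof -
    from bouquet[OF that] obtain p where "pentagon_bouquet k p (H_graph k x)"
      by blast
    then interpret pentagon_bouquet k p "H_graph k x" .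
    show ?thesis
      using simple mad not_odd_4_colorable bound[of k] by simp
  qed
  \<comment> \<open>One choice of identified vertices per \<open>k\<close> suffices; the vertex
    count \<open>4 * k + 1\<close> then separates the graphs, both as sets and up to
    isomorphism.\<close>
  define F where "F k = H_graph k (\<lambda>_. 0)" for k
  have zero: "\<forall>i\<in>{1..k}. 0 \<in> verts (cycle_graph 5)" for k :: nat
    by (simp add: cycle_graph_def)
  have F: "mad_bound_counterexample 4 (F k)" if "k \<ge> 1" for k
    using main[OF that zero]
    by (simp add: F_def mad_bound_counterexample_def odd_chromatic_number_le_iff)
  have card_F: "card (verts (F k)) = 4 * k + 1" if "k \<ge> 1" for k
    using bouquet[OF that zero] pentagon_bouquet.card_verts[of k _ "F k"] by (auto simp: F_def)
  have "inj_on F {1..}"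
  proof (rule inj_onI)
    fix k l :: nat
    assume "k \<in> {1..}" "l \<in> {1..}" and eq: "F k = F l"
    then have "k \<ge> 1" "l \<ge> 1"
      by simp_all
    from card_F[OF this(1)] card_F[OF this(2)] show "k = l"
      unfolding eq by linarith
  qed
  then have "infinite (F ` {1..})"
    by (simp add: finite_image_iff infinite_Ici)
  moreover have "pairwise (\<lambda>G G'. \<not> graph_iso G G') (F ` {1..})"
    unfolding pairwise_def
  proof (clarsimp)
    fix k l :: nat
    assume "Suc 0 \<le> k" "Suc 0 \<le> l" "F k \<noteq> F l" "graph_iso (F k) (F l)"
    then show False
      using graph_iso_card_verts[of "F k" "F l"] card_F[of k] card_F[of l] by auto
  qed
  moreover have "\<forall>G\<in>F ` {1..}. mad_bound_counterexample 4 G"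
    using F by auto
  moreover have "\<not> mad_bound_statement 4"
    using F[of 1] unfolding mad_bound_statement_def mad_bound_counterexample_def by blast
  ultimately show ?thesis
    by - (intro conjI exI[of _ "F ` {1..}"]; (intro allI impI main)?; assumption)
qed

end
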